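(* Fix an integer $k\ge 2$ and let the series $B_r$ ($r\ge 1$) and $\tilde{B}_r$ ($r\ge 2$, $r\not\equiv 1 \pmod{k-1}$) be defined as in the context. Then: (a) For every $j\ge 0$ and $i\in\{1,2,\dots,k\}$, $B_{(k-1)j+i}\in\mathbb{C}[[q]]$, and \[ B_{(k-1)j+i}=RHS_{j,i}:=\sum_{n\geq 0}(-1)^n\frac{q^{kn^2+((k-1)j+i-1)n}\,(1-q^{(2n+j+1)(k-i+1)})\,(1-q^{2(n+1)})\cdots(1-q^{2(n+j)})}{(q)_\infty\,(1+q)\cdots(1+q^j)}. \] (b) For each $j\ge 1$, $RHS_{j-1,k}=RHS_{j,1}$. (c) For every $j\ge 0$ and $i\in\{2,\dots,k\}$, $\tilde{B}_{(k-1)j+i}\in\mathbb{C}[[q]]$, and \[ \tilde{B}_{(k-1)j+i}=\sum_{n\geq 0}(-1)^n\frac{q^{kn^2+((k-1)j+i-2)n}\,(1-q^{2(n+1)})\cdots(1-q^{2(n+j)})\,(1+q^{2n+j+1})\,(1-q^{(2n+j+1)(k-i+1)})}{(q)_\infty\,(1+q)\cdots(1+q^{j+1})}. \] (For $j=0$, the empty products $(1-q^{2(n+1)})\cdots(1-q^{2(n+j)})$ and $(1+q)\cdots(1+q^j)$ equal $1$.)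
   Context: $q$ is a formal variable and all series are formal series in the field $\mathbb{C}((q))$ of formal Laurent series. Write $(q)_\infty=\prod_{s\ge1}(1-q^s)$. Fix an integer $k\ge 2$. For $i\in\{1,\dots,k\}$ set \[ B_i=\frac{\prod_{m\ge 1}(1-q^{2km})(1-q^{2km-k+i-1})(1-q^{2km-k-i+1})}{(q)_\infty}. \] Recursively, for each $j\ge 0$, once $B_{(k-1)j+1},\dots,B_{(k-1)j+k}$ are defined (the "$j$-th shelf"), define the ghost series \[ \tilde{B}_{(k-1)j+i}=\frac{B_{(k-1)j+i-1}+q^{j+1}B_{(k-1)j+i+1}}{1+q^{j+1}}\ (i\in\{2,\dots,k-1\}),\qquad \tilde{B}_{(k-1)j+k}=\frac{B_{(k-1)j+k-1}}{1+q^{j+1}}, \] and then the next shelf of official series by: $B_{(k-1)(j+1)+1}$ is the already defined $B_{(k-1)j+k}$, \[ B_{(k-1)(j+1)+2}=\frac{B_{(k-1)j+k-1}-\tilde{B}_{(k-1)j+k}}{q^{j+1}},\qquad B_{(k-1)(j+1)+i}=\frac{B_{(k-1)j+k-i+1}-\tilde{B}_{(k-1)j+k-i+2}}{q^{(j+1)(i-1)}}\ (i\in\{3,\dots,k\}). \] *)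

theory Defs
  imports "HOL-Analysis.Analysis" "HOL-Computational_Algebra.Formal_Laurent_Series"
begin

abbreviation q :: "complex fls" where
  "q \<equiv> fls_X"

text \<open>Infinite products and sums over \<^typ>\<open>complex fls\<close> are limits in the library's
  metric on formal Laurent series, i.e. in the \<open>q\<close>-adic topology.\<close>

definition qinf :: "complex fls" where
  "qinf = (\<Prod>s. 1 - q ^ Suc s)"

text \<open>The product variable is shifted (\<open>m \<ge> 1\<close> becomes \<open>Suc m\<close>). For \<open>1 \<le> i \<le> k\<close> the truncated
  subtractions in the exponents never truncate.\<close>

definition B_init :: "nat \<Rightarrow> nat \<Rightarrow> complex fls" where
  "B_init k i =
     (\<Prod>m. (1 - q ^ (2 * k * Suc m))
          * (1 - q ^ (2 * k * Suc m - k + i - 1))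
          * (1 - q ^ (2 * k * Suc m - k - i + 1))) / qinf"

text \<open>If \<open>S i\<close> is the official series in position \<open>i\<close> of shelf \<open>j\<close>, then \<open>ghost_step k j S i\<close> is
  the ghost series in position \<open>i\<close>, for \<open>2 \<le> i \<le> k\<close>.\<close>

definition ghost_step :: "nat \<Rightarrow> nat \<Rightarrow> (nat \<Rightarrow> complex fls) \<Rightarrow> nat \<Rightarrow> complex fls" where
  "ghost_step k j S i =
     (if i = k then S (k - 1) / (1 + q ^ (j + 1))
      else (S (i - 1) + q ^ (j + 1) * S (i + 1)) / (1 + q ^ (j + 1)))"

text \<open>The rules for positions \<open>2\<close> and \<open>i \<ge> 3\<close> of the next shelf are one formula, since
  \<open>k - 2 + 1 = k - 1\<close>, \<open>k - 2 + 2 = k\<close> and \<open>(j + 1) * (2 - 1) = j + 1\<close>.\<close>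

primrec shelf :: "nat \<Rightarrow> nat \<Rightarrow> nat \<Rightarrow> complex fls" where
  "shelf k 0 = B_init k"
| "shelf k (Suc j) =
     (\<lambda>i. if i = 1 then shelf k j k
          else (shelf k j (k - i + 1) - ghost_step k j (shelf k j) (k - i + 2))
               / q ^ ((j + 1) * (i - 1)))"

text \<open>The singly indexed sequences. Every \<open>r \<ge> 2\<close> is \<open>(k - 1) * j + i\<close> for exactly one
  \<open>j \<ge> 0\<close> and \<open>2 \<le> i \<le> k\<close>.\<close>

definition B :: "nat \<Rightarrow> nat \<Rightarrow> complex fls" where
  "B k r = (if r = 1 then shelf k 0 1
            else shelf k ((r - 2) div (k - 1)) ((r - 2) mod (k - 1) + 2))"

definition ghostB :: "nat \<Rightarrow> nat \<Rightarrow> complex fls" where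
  "ghostB k r =
     (let j = (r - 2) div (k - 1); i = (r - 2) mod (k - 1) + 2
      in ghost_step k j (\<lambda>i'. B k ((k - 1) * j + i')) i)"

definition RHS_term :: "nat \<Rightarrow> nat \<Rightarrow> nat \<Rightarrow> nat \<Rightarrow> complex fls" where
  "RHS_term k j i n =
     (-1) ^ n * (q ^ (k * n ^ 2 + ((k - 1) * j + i - 1) * n)
       * (1 - q ^ ((2 * n + j + 1) * (k - i + 1)))
       * (\<Prod>m = 1..j. 1 - q ^ (2 * (n + m))))
     / (qinf * (\<Prod>m = 1..j. 1 + q ^ m))"

definition RHS :: "nat \<Rightarrow> nat \<Rightarrow> nat \<Rightarrow> complex fls" where
  "RHS k j i = (\<Sum>n. RHS_term k j i n)"

definition ghost_RHS_term :: "nat \<Rightarrow> nat \<Rightarrow> nat \<Rightarrow> nat \<Rightarrow> complex fls" where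
  "ghost_RHS_term k j i n =
     (-1) ^ n * (q ^ (k * n ^ 2 + ((k - 1) * j + i - 2) * n)
       * (\<Prod>m = 1..j. 1 - q ^ (2 * (n + m)))
       * (1 + q ^ (2 * n + j + 1))
       * (1 - q ^ ((2 * n + j + 1) * (k - i + 1))))
     / (qinf * (\<Prod>m = 1..j + 1. 1 + q ^ m))"

definition ghost_RHS :: "nat \<Rightarrow> nat \<Rightarrow> nat \<Rightarrow> complex fls" where
  "ghost_RHS k j i = (\<Sum>n. ghost_RHS_term k j i n)"


subsection \<open>The sequences satisfy the recursion\<close>

lemma index_div_mod:
  fixes k j i :: nat
  assumes "2 \<le> i" "i \<le> k"
  shows "((k - 1) * j + i - 2) div (k - 1) = j" "((k - 1) * j + i - 2) mod (k - 1) + 2 = i"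
proof -
  have "(k - 1) * j + i - 2 = (i - 2) + (k - 1) * j" "i - 2 < k - 1"
    using assms by auto
  then show "((k - 1) * j + i - 2) div (k - 1) = j" "((k - 1) * j + i - 2) mod (k - 1) + 2 = i"
    using assms by (simp_all only: div_mult_self2 mod_mult_self2) auto
qed

lemma B_shelf:
  assumes "k \<ge> 2" "i \<in> {1..k}"
  shows "B k ((k - 1) * j + i) = shelf k j i"
proof -
  have *: "B k ((k - 1) * j + i) = shelf k j i" if "2 \<le> i" "i \<le> k" for i j
    using index_div_mod[OF that, of j] that by (simp add: B_def)
  show ?thesis
  proof (cases "i = 1")
    case True
    show ?thesis
    proof (cases j)
      case 0
      then show ?thesis using True by (simp add: B_def)
    next
      case (Suc j')
      have eq: "(k - 1) * j + i = (k - 1) * j' + k"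
        using Suc True assms by simp
      have "B k ((k - 1) * j' + k) = shelf k j' k"
        using assms by (intro *) auto
      then show ?thesis
        unfolding eq using True Suc by simp
    qed
  qed (use * assms in auto)
qed

lemma B_initial:
  assumes "k \<ge> 2" "i \<in> {1..k}"
  shows "B k i = B_init k i"
  using B_shelf[OF assms, of 0] by simp

lemma ghostB_eq:
  assumes "2 \<le> i" "i \<le> k"
  shows "ghostB k ((k - 1) * j + i) = ghost_step k j (\<lambda>i'. B k ((k - 1) * j + i')) i"
  using index_div_mod[OF assms, of j] by (simp add: ghostB_def Let_def)

lemma ghostB_inner:
  assumes "k \<ge> 2" "i \<in> {2..k - 1}"
  shows "ghostB k ((k - 1) * j + i) =
    (B k ((k - 1) * j + i - 1) + q ^ (j + 1) * B k ((k - 1) * j + i + 1)) / (1 + q ^ (j + 1))"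
  using assms by (subst ghostB_eq) (auto simp: ghost_step_def)

lemma ghostB_last:
  assumes "k \<ge> 2"
  shows "ghostB k ((k - 1) * j + k) = B k ((k - 1) * j + k - 1) / (1 + q ^ (j + 1))"
  using assms by (subst ghostB_eq) (auto simp: ghost_step_def)

lemma ghost_step_cong:
  assumes "2 \<le> i" "i \<le> k" "\<And>i. i \<in> {1..k} \<Longrightarrow> S i = S' i"
  shows "ghost_step k j S i = ghost_step k j S' i"
proof -
  have "i - 1 \<in> {1..k}" "k - 1 \<in> {1..k}" "i \<noteq> k \<Longrightarrow> i + 1 \<in> {1..k}"
    using assms(1,2) by auto
  then show ?thesis
    unfolding ghost_step_def using assms(3) by metis
qed

lemma B_next:
  assumes "k \<ge> 2" "i \<in> {2..k}"
  shows "B k ((k - 1) * (j + 1) + i) =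
    (B k ((k - 1) * j + k - i + 1) - ghostB k ((k - 1) * j + k - i + 2)) / q ^ ((j + 1) * (i - 1))"
proof -
  have "B k ((k - 1) * (j + 1) + i) = shelf k (Suc j) i"
    using B_shelf[of k i "j + 1"] assms by auto
  also have "\<dots> = (shelf k j (k - i + 1) - ghost_step k j (shelf k j) (k - i + 2))
               / q ^ ((j + 1) * (i - 1))"
    using assms by auto
  also have "shelf k j (k - i + 1) = B k ((k - 1) * j + (k - i + 1))"
    by (rule B_shelf[symmetric]) (use assms in auto)
  also have "ghost_step k j (shelf k j) (k - i + 2) = ghostB k ((k - 1) * j + (k - i + 2))"
  proof -
    have "ghost_step k j (shelf k j) (k - i + 2) =
        ghost_step k j (\<lambda>i'. B k ((k - 1) * j + i')) (k - i + 2)"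
      by (rule ghost_step_cong) (use assms B_shelf[OF assms(1), symmetric] in auto)
    then show ?thesis
      using assms by (subst ghostB_eq) auto
  qed
  also have "(k - 1) * j + (k - i + 1) = (k - 1) * j + k - i + 1"
    using assms by auto
  also have "(k - 1) * j + (k - i + 2) = (k - 1) * j + k - i + 2"
    using assms by auto
  finally show ?thesis .
qed

lemma B_next_second:
  assumes "k \<ge> 2"
  shows "B k ((k - 1) * (j + 1) + 2) =
    (B k ((k - 1) * j + k - 1) - ghostB k ((k - 1) * j + k)) / q ^ (j + 1)"
proof -
  have "(k - 1) * j + k - 2 + 1 = (k - 1) * j + k - 1" "(k - 1) * j + k - 2 + 2 = (k - 1) * j + k"
    using assms by auto
  then show ?thesis
    using B_next[of k 2 j] assms by simp
qed


subsection \<open>The infinite products and sums converge\<close>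

lemma tendsto_fps_to_fls:
  fixes F :: "nat \<Rightarrow> complex fps"
  assumes "F \<longlonglongrightarrow> G"
  shows "(\<lambda>n. fps_to_fls (F n)) \<longlonglongrightarrow> fps_to_fls G"
proof -
  have "dist (fps_to_fls a) (fps_to_fls b) = dist a b" for a b :: "complex fps"
    by (simp add: dist_fls_def dist_fps_def fls_subdegree_fls_to_fps flip: fps_to_fls_minus)
  then show ?thesis
    using assms by (simp add: tendsto_iff)
qed

lemma fls_prod_fps:
  fixes G :: "nat \<Rightarrow> complex fps"
  defines "F \<equiv> \<lambda>m. 1 + fps_X ^ Suc m * G m"
  shows "\<exists>P. fps_nth P 0 = 1 \<and> (\<lambda>m. fps_to_fls (F m)) has_prod fps_to_fls P"
proof -
  define P where "P = Abs_fps (\<lambda>n. fps_nth (\<Prod>m\<le>n. F m) n)"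
  have stable: "fps_nth (\<Prod>m\<le>n + d. F m) n = fps_nth (\<Prod>m\<le>n. F m) n" for n d
  proof (induction d)
    case (Suc d)
    have "(\<Prod>m\<le>n + Suc d. F m) =
        (\<Prod>m\<le>n + d. F m) + fps_X ^ (n + d + 2) * (G (n + d + 1) * (\<Prod>m\<le>n + d. F m))"
      by (simp add: F_def algebra_simps)
    then show ?case
      by (simp only: fps_add_nth fps_X_power_mult_nth) (simp add: Suc)
  qed simp
  have lim: "(\<lambda>N. \<Prod>m\<le>N. F m) \<longlonglongrightarrow> P"
  proof (rule tendsto_fpsI)
    fix n
    show "\<forall>\<^sub>F N in sequentially. fps_nth (\<Prod>m\<le>N. F m) n = fps_nth P n"
      using eventually_ge_at_top[of n]
    proof eventually_elim
      case (elim N)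
      then show ?case using stable[of n "N - n"] by (simp add: P_def)
    qed
  qed
  have P0: "fps_nth P 0 = 1"
    by (simp add: P_def F_def)
  have "(\<Prod>m\<le>N. fps_to_fls (F m)) = fps_to_fls (\<Prod>m\<le>N. F m)" for N
    by (induction N) (simp_all add: fls_times_fps_to_fls)
  then have "(\<lambda>N. \<Prod>m\<le>N. fps_to_fls (F m)) \<longlonglongrightarrow> fps_to_fls P"
    using tendsto_fps_to_fls[OF lim] by simp
  moreover have "P \<noteq> 0"
    using P0 by auto
  ultimately have "(\<lambda>m. fps_to_fls (F m)) has_prod fps_to_fls P"
    by (simp add: has_prod_def raw_has_prod_def)
  with P0 show ?thesis by blast
qed

lemma qinf_has_prod: "(\<lambda>s. 1 - q ^ Suc s) has_prod qinf"
  and qinf_fps: "\<exists>P. fps_nth P 0 = 1 \<and> qinf = fps_to_fls P"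
proof -
  obtain P :: "complex fps" where P: "fps_nth P 0 = 1"
      "(\<lambda>m. fps_to_fls (1 + fps_X ^ Suc m * (-1))) has_prod fps_to_fls P"
    using fls_prod_fps[of "\<lambda>_. -1"] by blast
  have "(\<lambda>s. 1 - q ^ Suc s) = (\<lambda>m. fps_to_fls (1 + fps_X ^ Suc m * (-1)))"
    by (simp add: fps_to_fls_power fls_times_fps_to_fls)
  with P have *: "(\<lambda>s. 1 - q ^ Suc s) has_prod fps_to_fls P"
    by simp
  then have "qinf = fps_to_fls P"
    unfolding qinf_def by (rule has_prod_unique[symmetric])
  with * P show "(\<lambda>s. 1 - q ^ Suc s) has_prod qinf"
    "\<exists>P. fps_nth P 0 = 1 \<and> qinf = fps_to_fls P" by auto
qed

lemma B_init_has_prod: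
  assumes "i \<in> {1..k}"
  defines "f \<equiv> \<lambda>m. (1 - q ^ (2 * k * Suc m))
          * (1 - q ^ (2 * k * Suc m - k + i - 1))
          * (1 - q ^ (2 * k * Suc m - k - i + 1))"
  shows "f has_prod (\<Prod>m. f m)"
proof -
  define a b c where "a = (\<lambda>m. 2 * k * Suc m - Suc m)"
    and "b = (\<lambda>m. 2 * k * Suc m - k + i - 1 - Suc m)"
    and "c = (\<lambda>m. 2 * k * Suc m - k - i + 1 - Suc m)"
  have abc: "2 * k * Suc m = Suc m + a m" "2 * k * Suc m - k + i - 1 = Suc m + b m"
      "2 * k * Suc m - k - i + 1 = Suc m + c m" for m
  proof -
    obtain t where t: "t = 2 * k * Suc m" by simp
    have "k * m \<ge> m" using assms by auto
    then have "t \<ge> 2 * k + 2 * m" by (simp add: t algebra_simps)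
    moreover have "1 \<le> i" "i \<le> k" using assms by auto
    ultimately show "2 * k * Suc m = Suc m + a m" "2 * k * Suc m - k + i - 1 = Suc m + b m"
        "2 * k * Suc m - k - i + 1 = Suc m + c m"
      unfolding a_def b_def c_def t[symmetric] by linarith+
  qed
  define X where "X = (fps_X :: complex fps)"
  define G where "G = (\<lambda>m. - (X ^ a m) - X ^ b m - X ^ c m
     + X ^ Suc m * (X ^ a m * X ^ b m + X ^ b m * X ^ c m + X ^ a m * X ^ c m)
     - X ^ Suc m * X ^ Suc m * (X ^ a m * X ^ b m * X ^ c m))"
  have expand: "1 + x * (- u - v - w + x * (u * v + v * w + u * w) - x * x * (u * v * w)) =
      (1 - x * u) * (1 - x * v) * (1 - x * w)" for x u v w :: "complex fps"
    by (simp add: algebra_simps)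
  have eq: "1 + X ^ Suc m * G m =
      (1 - X ^ (Suc m + a m)) * (1 - X ^ (Suc m + b m)) * (1 - X ^ (Suc m + c m))" for m
    unfolding G_def power_add by (rule expand)
  have "f = (\<lambda>m. fps_to_fls (1 + X ^ Suc m * G m))"
    unfolding f_def eq unfolding abc(2,3) unfolding abc(1) X_def
    by (simp only: fps_to_fls_power fls_times_fps_to_fls fps_to_fls_minus fps_one_to_fls fps_X_to_fls)
  then show ?thesis
    using fls_prod_fps[of G] has_prod_unique unfolding X_def by metis
qed

lemma fls_summable_fps:
  fixes G :: "nat \<Rightarrow> complex fps"
  shows "summable (\<lambda>n. fps_to_fls (fps_X ^ n * G n))"
proof -
  define S where "S = Abs_fps (\<lambda>m. \<Sum>n\<le>m. fps_nth (fps_X ^ n * G n) m)"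
  have lim: "(\<lambda>N. \<Sum>n<N. fps_X ^ n * G n) \<longlonglongrightarrow> S"
  proof (rule tendsto_fpsI)
    fix m
    show "\<forall>\<^sub>F N in sequentially. fps_nth (\<Sum>n<N. fps_X ^ n * G n) m = fps_nth S m"
      using eventually_gt_at_top[of m]
    proof eventually_elim
      case (elim N)
      have "(\<Sum>n<N. fps_nth (fps_X ^ n * G n) m) = (\<Sum>n\<le>m. fps_nth (fps_X ^ n * G n) m)"
        by (rule sum.mono_neutral_right) (use elim in \<open>auto simp: fps_X_power_mult_nth\<close>)
      then show ?case by (simp add: S_def fps_sum_nth)
    qed
  qed
  have "(\<Sum>n<N. fps_to_fls (fps_X ^ n * G n)) = fps_to_fls (\<Sum>n<N. fps_X ^ n * G n)" for N
    by (induction N) simp_all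
  then show ?thesis
    using tendsto_fps_to_fls[OF lim] by (auto simp: summable_def sums_def)
qed

lemma fls_summable_aux:
  fixes A D :: "complex fps"
  assumes "\<And>n. n \<le> e n" "fps_nth D 0 = 1"
  shows "summable (\<lambda>n. (-1) ^ n * (q ^ e n * fps_to_fls (N n)) / fps_to_fls D)"
proof -
  have D: "fps_to_fls (inverse D) = inverse (fps_to_fls D)"
    by (rule inverse_unique[symmetric])
       (use assms(2) in \<open>simp add: inverse_mult_eq_1' flip: fls_times_fps_to_fls\<close>)
  define G where "G = (\<lambda>n. (-1) ^ n * fps_X ^ (e n - n) * N n * inverse D)"
  have m1: "fps_to_fls (-1) = (-1 :: complex fls)"
    by (simp flip: fps_one_to_fls)
  have "(-1) ^ n * (q ^ e n * fps_to_fls (N n)) / fps_to_fls D = fps_to_fls (fps_X ^ n * G n)" for n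
  proof -
    have "q ^ e n = q ^ n * q ^ (e n - n)"
      using assms(1)[of n] by (simp flip: power_add)
    then show ?thesis
      by (simp only: G_def fls_times_fps_to_fls fps_to_fls_power D fps_X_to_fls m1 divide_inverse
        mult_ac)
  qed
  then show ?thesis
    using fls_summable_fps[of G] by simp
qed

lemma fps_to_fls_prod: "fps_to_fls (\<Prod>m\<in>A. F m) = (\<Prod>m\<in>A. fps_to_fls (F m :: complex fps))"
  by (induction A rule: infinite_finite_induct) (simp_all add: fls_times_fps_to_fls)

lemma denominator_fps:
  "\<exists>D. fps_nth D 0 = 1 \<and> qinf * (\<Prod>m = 1..j. 1 + q ^ m) = fps_to_fls D"
proof -
  obtain P where P: "fps_nth P 0 = 1" "qinf = fps_to_fls P"
    using qinf_fps by blast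
  have "fps_nth (\<Prod>m = 1..j. 1 + fps_X ^ m :: complex fps) 0 = 1"
    by (induction j) simp_all
  then show ?thesis
    using P by (intro exI[of _ "P * (\<Prod>m = 1..j. 1 + fps_X ^ m)"])
      (simp add: fls_times_fps_to_fls fps_to_fls_prod fps_to_fls_power)
qed

lemma exponent_ge: "n \<le> k * n ^ 2 + c * n" if "k \<ge> 2" for k c n :: nat
proof -
  have "n \<le> 1 * n ^ 2" by (simp add: power2_eq_square)
  also have "\<dots> \<le> k * n ^ 2" using that by (intro mult_right_mono) auto
  finally show ?thesis by simp
qed

lemma RHS_summable:
  assumes "k \<ge> 2"
  shows "summable (RHS_term k j i)"
proof -
  obtain D where D: "fps_nth D 0 = 1" "qinf * (\<Prod>m = 1..j. 1 + q ^ m) = fps_to_fls D"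
    using denominator_fps by blast
  define N :: "nat \<Rightarrow> complex fps" where "N = (\<lambda>n. (1 - fps_X ^ ((2 * n + j + 1) * (k - i + 1)))
     * (\<Prod>m = 1..j. 1 - fps_X ^ (2 * (n + m))))"
  have "RHS_term k j i = (\<lambda>n. (-1) ^ n * (q ^ (k * n ^ 2 + ((k - 1) * j + i - 1) * n)
      * fps_to_fls (N n)) / fps_to_fls D)"
    unfolding RHS_term_def D N_def
    by (simp only: fls_times_fps_to_fls fps_to_fls_prod fps_to_fls_power fps_to_fls_minus
      fps_one_to_fls fps_X_to_fls mult.assoc)
  then show ?thesis
    using fls_summable_aux[OF exponent_ge[OF assms] D(1)] by simp
qed

lemma ghost_RHS_summable:
  assumes "k \<ge> 2"
  shows "summable (ghost_RHS_term k j i)"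
proof -
  obtain D where D: "fps_nth D 0 = 1" "qinf * (\<Prod>m = 1..j + 1. 1 + q ^ m) = fps_to_fls D"
    using denominator_fps by blast
  define N :: "nat \<Rightarrow> complex fps" where "N = (\<lambda>n. (\<Prod>m = 1..j. 1 - fps_X ^ (2 * (n + m)))
     * (1 + fps_X ^ (2 * n + j + 1)) * (1 - fps_X ^ ((2 * n + j + 1) * (k - i + 1))))"
  have "ghost_RHS_term k j i = (\<lambda>n. (-1) ^ n * (q ^ (k * n ^ 2 + ((k - 1) * j + i - 2) * n)
      * fps_to_fls (N n)) / fps_to_fls D)"
    unfolding ghost_RHS_term_def D N_def
    by (simp only: fls_times_fps_to_fls fps_to_fls_prod fps_to_fls_power fps_to_fls_minus
      fps_to_fls_plus fps_one_to_fls fps_X_to_fls mult.assoc)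
  then show ?thesis
    using fls_summable_aux[OF exponent_ge[OF assms] D(1)] by simp
qed

end

theory Submission
  imports Defs
begin

text \<open>
  For shelf \<open>0\<close> the claim is the Jacobi triple product identity, with the terms at \<open>n\<close> and
  \<open>- n - 1\<close> of the bilateral sum combined. It is the limit of a finite version coming from the
  q-binomial theorem.

  Write \<open>w\<close> for the (2n+j+1)st and \<open>y\<close> for the (j+1)st power of \<open>q\<close>. The ghost series follow
  termwise from \<open>(1 - w\<^sup>l\<^sup>+\<^sup>1) + w (1 - w\<^sup>l\<^sup>-\<^sup>1) = (1 + w) (1 - w\<^sup>l)\<close>. For the next shelf,
  \<open>(1 - w\<^sup>i) (1 + y) - (1 + w) (1 - w\<^sup>i\<^sup>-\<^sup>1) = y (1 - q\<^sup>2\<^sup>n) + w\<^sup>i\<^sup>-\<^sup>1 (1 - y w)\<close>, and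
  regrouping the second part of the \<open>n\<close>th term with the first part of the \<open>n + 1\<close>st gives the
  \<open>n\<close>th term of the next series. For \<open>i = 1\<close> the same computation gives (b).
\<close>


subsection \<open>The q-adic topology on formal Laurent series\<close>

text \<open>For \<open>m = 0\<close> this is the ring of formal power series, for other \<open>m\<close> the fractional ideal
  generated by the \<open>m\<close>th power of the variable.\<close>

definition fls_ideal :: "int \<Rightarrow> 'a::zero fls set" where
  "fls_ideal m = {f. \<forall>n<m. fls_nth f n = 0}"

lemma fls_ideal_iff: "f \<in> fls_ideal m \<longleftrightarrow> f = 0 \<or> m \<le> fls_subdegree f"
  by (auto simp: fls_ideal_def intro: fls_subdegree_geI)

lemma fls_ideal_mono: "f \<in> fls_ideal m \<Longrightarrow> m' \<le> m \<Longrightarrow> f \<in> fls_ideal m'"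
  by (auto simp: fls_ideal_def)

lemma fls_ideal_0 [simp]: "0 \<in> fls_ideal m"
  by (simp add: fls_ideal_def)

lemma fls_ideal_add: "f \<in> fls_ideal m \<Longrightarrow> g \<in> fls_ideal m \<Longrightarrow> f + g \<in> fls_ideal m"
  for f g :: "'a::monoid_add fls"
  by (simp add: fls_ideal_def)

lemma fls_ideal_diff: "f \<in> fls_ideal m \<Longrightarrow> g \<in> fls_ideal m \<Longrightarrow> f - g \<in> fls_ideal m"
  for f g :: "'a::group_add fls"
  by (simp add: fls_ideal_def)

lemma fls_ideal_sum: "(\<And>a. a \<in> A \<Longrightarrow> f a \<in> fls_ideal m) \<Longrightarrow> sum f A \<in> fls_ideal m"
  for f :: "'b \<Rightarrow> 'a::comm_monoid_add fls"
  by (induction A rule: infinite_finite_induct) (auto intro: fls_ideal_add)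

lemma fls_ideal_mult: "f \<in> fls_ideal m \<Longrightarrow> g \<in> fls_ideal n \<Longrightarrow> f * g \<in> fls_ideal (m + n)"
  for f g :: "'a::idom fls"
  by (cases "f = 0 \<or> g = 0") (auto simp: fls_ideal_iff)

lemma fls_ideal_mult0: "f \<in> fls_ideal m \<Longrightarrow> g \<in> fls_ideal 0 \<Longrightarrow> f * g \<in> fls_ideal m"
  for f g :: "'a::idom fls"
  using fls_ideal_mult[of f m g 0] by simp

lemma fls_ideal_1 [simp]: "1 \<in> fls_ideal 0"
  by (simp add: fls_ideal_iff)

lemma fls_ideal_prod: "(\<And>a. a \<in> A \<Longrightarrow> f a \<in> fls_ideal 0) \<Longrightarrow> prod f A \<in> fls_ideal 0"
  for f :: "'b \<Rightarrow> 'a::idom fls"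
  by (induction A rule: infinite_finite_induct) (auto intro: fls_ideal_mult0)

lemma fls_ideal_X_power: "m \<le> int e \<Longrightarrow> fls_X ^ e \<in> fls_ideal m"
  by (simp add: fls_ideal_iff)

lemma fls_ideal_m1_power [simp]: "(-1) ^ n \<in> (fls_ideal 0 :: 'a::idom fls set)" for n :: nat
  by (cases "even n") (simp_all add: fls_ideal_iff)

text \<open>Turns the integrality claims of (a) and (c) into membership in
  \<open>fls_ideal 0\<close>, which passes to infinite sums by
  \<open>sums_fls_ideal\<close>.\<close>

lemma range_fps_to_fls: "range fps_to_fls = (fls_ideal 0 :: 'a::zero fls set)"
proof safe
  fix f :: "'a fls"
  assume "f \<in> fls_ideal 0"
  then have "fls_subdegree f \<ge> 0"
    by (auto simp: fls_ideal_iff)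
  then show "f \<in> range fps_to_fls"
    by (metis fls_regpart_to_fls_trivial rangeI)
qed (simp add: fls_ideal_def)

text \<open>A series of subdegree s > 0 has distance 1/2^s from 0, so the ideals form a
  neighbourhood base of 0 and limits become congruences.\<close>

lemma tendsto_fls_iff:
  fixes f :: "'b \<Rightarrow> 'a::group_add fls"
  shows "(f \<longlongrightarrow> l) F \<longleftrightarrow> (\<forall>m. \<forall>\<^sub>F x in F. f x - l \<in> fls_ideal m)"
proof
  assume lim: "(f \<longlongrightarrow> l) F"
  show "\<forall>m. \<forall>\<^sub>F x in F. f x - l \<in> fls_ideal m"
  proof
    fix m :: int
    \<comment> \<open>For negative \<open>m\<close> the radius is 1, which already forces a nonzero
      difference to have positive subdegree.\<close>
    have "\<forall>\<^sub>F x in F. dist (f x) l < inverse (2 ^ nat m)"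
      using lim by (rule tendstoD) simp
    then show "\<forall>\<^sub>F x in F. f x - l \<in> fls_ideal m"
    proof eventually_elim
      case (elim x)
      have "m \<le> fls_subdegree (f x - l)" if "f x \<noteq> l"
      proof (cases "fls_subdegree (f x - l) \<ge> 0")
        case True
        then have "(2::real) ^ nat m < 2 ^ nat (fls_subdegree (f x - l))"
          using elim that by (simp add: dist_fls_def)
        then show ?thesis using True by simp
      next
        case False
        then have "2 ^ nat (- fls_subdegree (f x - l)) < inverse ((2::real) ^ nat m)"
          using elim that by (simp add: dist_fls_def)
        also have "\<dots> \<le> 1" by (simp add: inverse_le_1_iff)
        finally have False
          by (metis not_less two_realpow_ge_one)
        then show ?thesis ..
      qed
      then show ?case by (auto simp: fls_ideal_iff)
    qed
  qed
next
  assume ev: "\<forall>m. \<forall>\<^sub>F x in F. f x - l \<in> fls_ideal m"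
  show "(f \<longlongrightarrow> l) F"
  proof (rule tendstoI)
    fix e :: real assume "e > 0"
    obtain N where N: "inverse (2 ^ N) < e"
      using real_arch_pow_inv[OF \<open>e > 0\<close>, of "1/2"] by (auto simp: power_one_over field_simps)
    have "\<forall>\<^sub>F x in F. f x - l \<in> fls_ideal (int N)"
      using ev by blast
    then show "\<forall>\<^sub>F x in F. dist (f x) l < e"
    proof eventually_elim
      case (elim x)
      show ?case
      proof (cases "f x = l")
        case False
        then have *: "int N \<le> fls_subdegree (f x - l)"
          using elim by (simp add: fls_ideal_iff)
        then have "dist (f x) l = inverse (2 ^ nat (fls_subdegree (f x - l)))"
          using False by (simp add: dist_fls_def)
        also have "\<dots> \<le> inverse (2 ^ N)"
          using * by (intro le_imp_inverse_le power_increasing) auto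
        finally show ?thesis using N by simp
      qed (use \<open>e > 0\<close> in simp)
    qed
  qed
qed

lemma tendsto_fls_add:
  fixes f g :: "'b \<Rightarrow> 'a::ab_group_add fls"
  assumes "(f \<longlongrightarrow> a) F" "(g \<longlongrightarrow> b) F"
  shows "((\<lambda>x. f x + g x) \<longlongrightarrow> a + b) F"
  unfolding tendsto_fls_iff
proof
  fix m
  have "\<forall>\<^sub>F x in F. f x - a \<in> fls_ideal m" "\<forall>\<^sub>F x in F. g x - b \<in> fls_ideal m"
    using assms unfolding tendsto_fls_iff by blast+
  then show "\<forall>\<^sub>F x in F. f x + g x - (a + b) \<in> fls_ideal m"
    by eventually_elim (metis add_diff_add fls_ideal_add)
qed

lemma tendsto_fls_mult_left:
  fixes f :: "'b \<Rightarrow> 'a::idom fls"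
  assumes "(f \<longlongrightarrow> a) F"
  shows "((\<lambda>x. c * f x) \<longlongrightarrow> c * a) F"
  unfolding tendsto_fls_iff
proof
  fix m
  \<comment> \<open>Multiplication by \<open>c\<close> shifts the ideals by its subdegree, possibly
    negative, so the precision demanded of \<open>f\<close> is adjusted.\<close>
  have "\<forall>\<^sub>F x in F. f x - a \<in> fls_ideal (m - fls_subdegree c)"
    using assms unfolding tendsto_fls_iff by blast
  then show "\<forall>\<^sub>F x in F. c * f x - c * a \<in> fls_ideal m"
  proof eventually_elim
    case (elim x)
    have "c \<in> fls_ideal (fls_subdegree c)" by (simp add: fls_ideal_iff)
    from fls_ideal_mult[OF this elim] show ?case by (simp add: algebra_simps)
  qed
qed

lemma sums_fls_add:
  fixes f g :: "nat \<Rightarrow> 'a::ab_group_add fls"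
  shows "f sums a \<Longrightarrow> g sums b \<Longrightarrow> (\<lambda>n. f n + g n) sums (a + b)"
  unfolding sums_def sum.distrib by (rule tendsto_fls_add)

lemma sums_fls_mult:
  fixes f :: "nat \<Rightarrow> 'a::idom fls"
  shows "f sums a \<Longrightarrow> (\<lambda>n. c * f n) sums (c * a)"
  unfolding sums_def sum_distrib_left[symmetric] by (rule tendsto_fls_mult_left)

lemma sums_fls_diff:
  fixes f g :: "nat \<Rightarrow> 'a::idom fls"
  assumes "f sums a" "g sums b"
  shows "(\<lambda>n. f n - g n) sums (a - b)"
  using sums_fls_add[OF assms(1) sums_fls_mult[OF assms(2), of "-1"]] by simp

text \<open>The partial sums collapse to \<open>u n\<close>, which tends to 0.\<close>

lemma sums_fls_telescope:
  fixes u :: "nat \<Rightarrow> 'a::ab_group_add fls"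
  assumes "\<And>n. u n \<in> fls_ideal (int n)" "u 0 = 0"
  shows "(\<lambda>n. u (Suc n) - u n) sums 0"
  unfolding sums_def sum_lessThan_telescope tendsto_fls_iff assms(2) diff_0_right
proof
  fix m
  show "\<forall>\<^sub>F n in sequentially. u n \<in> fls_ideal m"
    using eventually_ge_at_top[of "nat m"]
    by eventually_elim (metis assms(1) fls_ideal_mono nat_le_iff)
qed

text \<open>The ideals are closed: a late partial sum lies in the ideal and differs from the limit
  by an element of it.\<close>

lemma sums_fls_ideal:
  fixes f :: "nat \<Rightarrow> 'a::ab_group_add fls"
  assumes "f sums a" "\<And>n. f n \<in> fls_ideal m"
  shows "a \<in> fls_ideal m"
proof -
  have "\<forall>\<^sub>F N in sequentially. (\<Sum>n<N. f n) - a \<in> fls_ideal m"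
    using assms(1) unfolding sums_def tendsto_fls_iff by blast
  then obtain N where "(\<Sum>n<N. f n) - a \<in> fls_ideal m"
    by (auto simp: eventually_sequentially)
  then have "(\<Sum>n<N. f n) - ((\<Sum>n<N. f n) - a) \<in> fls_ideal m"
    by (rule fls_ideal_diff[OF fls_ideal_sum[OF assms(2)]])
  then show ?thesis by (simp add: algebra_simps)
qed


subsection \<open>A finite form of the Jacobi triple product\<close>

text \<open>The q-Pochhammer symbol (p; p)_n.\<close>

definition qpoch :: "'a::comm_ring_1 \<Rightarrow> nat \<Rightarrow> 'a" where
  "qpoch p n = (\<Prod>m<n. 1 - p ^ Suc m)"

text \<open>Gaussian binomial coefficients. The q-Pascal recursion avoids division, so they make
  sense over any commutative ring.\<close>

fun qbinomial :: "'a::comm_ring_1 \<Rightarrow> nat \<Rightarrow> nat \<Rightarrow> 'a" where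
  "qbinomial p M 0 = 1"
| "qbinomial p 0 (Suc r) = 0"
| "qbinomial p (Suc M) (Suc r) = qbinomial p M (Suc r) + p ^ (M - r) * qbinomial p M r"

lemma qbinomial_eq_0: "M < r \<Longrightarrow> qbinomial p M r = 0"
  by (induction p M r rule: qbinomial.induct) auto

text \<open>The quotient formula for Gaussian binomials with denominators cleared, by induction
  along the q-Pascal rule.\<close>

lemma qbinomial_qpoch:
  "r \<le> M \<Longrightarrow> qbinomial p M r * qpoch p r * qpoch p (M - r) = qpoch p M"
proof (induction p M r rule: qbinomial.induct)
  case (3 p M r)
  have *: "p ^ (M - r) * qbinomial p M r * qpoch p (Suc r) * qpoch p (M - r)
      = p ^ (M - r) * (1 - p ^ Suc r) * qpoch p M"
  proof -
    have "qpoch p (Suc r) = qpoch p r * (1 - p ^ Suc r)"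
      by (simp add: qpoch_def)
    then have "p ^ (M - r) * qbinomial p M r * qpoch p (Suc r) * qpoch p (M - r)
        = p ^ (M - r) * (1 - p ^ Suc r) * (qbinomial p M r * qpoch p r * qpoch p (M - r))"
      by (simp only: mult_ac)
    then show ?thesis using 3 by simp
  qed
  \<comment> \<open>The case \<open>r = M\<close> is separate: there the summand with
    \<open>Suc r\<close> vanishes and \<open>M - Suc r\<close> would truncate.\<close>
  show ?case
  proof (cases "r = M")
    case True
    then show ?thesis using * by (simp add: qbinomial_eq_0 qpoch_def algebra_simps)
  next
    case False
    then have r: "Suc r \<le> M" using 3 by simp
    then have "M - r = Suc (M - Suc r)" by simp
    then have "qpoch p (M - r) = qpoch p (M - Suc r) * (1 - p ^ (M - r))"
      by (simp add: qpoch_def)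
    then have "qbinomial p M (Suc r) * qpoch p (Suc r) * qpoch p (M - r) = qpoch p M * (1 - p ^ (M - r))"
      using 3(1)[OF r] by (simp add: mult.assoc[symmetric])
    with * have "qbinomial p (Suc M) (Suc r) * qpoch p (Suc r) * qpoch p (M - r) =
        qpoch p M * (1 - p ^ (M - r)) + p ^ (M - r) * (1 - p ^ Suc r) * qpoch p M"
      by (simp add: distrib_right)
    also have "\<dots> = qpoch p M * (1 - p ^ (M - r) * p ^ Suc r)"
      by (simp add: algebra_simps)
    also have "p ^ (M - r) * p ^ Suc r = p ^ Suc M"
      unfolding power_add[symmetric] using r by simp
    finally show ?thesis by (simp add: qpoch_def)
  qed
qed (auto simp: qpoch_def)

lemma qpoch_nonzero:
  fixes p :: "'a::idom"
  assumes "\<And>m. m > 0 \<Longrightarrow> p ^ m \<noteq> 1"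
  shows "qpoch p n \<noteq> 0"
proof -
  have "1 - p ^ Suc m \<noteq> 0" for m
    using assms[of "Suc m"] by simp
  then show ?thesis unfolding qpoch_def by (simp only: prod_zero_iff[OF finite_lessThan]) blast
qed

text \<open>Both coefficients solve the same equation by \<open>qbinomial_qpoch\<close>; the
  hypothesis on \<open>p\<close> makes the Pochhammer factors cancellable.\<close>

lemma qbinomial_symmetric:
  fixes p :: "'a::idom"
  assumes "\<And>m. m > 0 \<Longrightarrow> p ^ m \<noteq> 1" "r \<le> M"
  shows "qbinomial p M (M - r) = qbinomial p M r"
proof -
  have "qbinomial p M (M - r) * qpoch p r * qpoch p (M - r) = qbinomial p M r * qpoch p r * qpoch p (M - r)"
    using qbinomial_qpoch[of r M p] qbinomial_qpoch[of "M - r" M p] assms(2) by (simp add: mult_ac)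
  then show ?thesis using qpoch_nonzero[of p] assms(1) by simp
qed

text \<open>Induction peeling off the last factor \<open>a + b * p ^ M\<close>; the summands inherit
  a q-Pascal rule.\<close>

lemma qbinomial_theorem:
  "(\<Prod>m<M. a + b * p ^ m) = (\<Sum>r\<le>M. p ^ (r choose 2) * qbinomial p M r * a ^ (M - r) * b ^ r)"
proof (induction M)
  case (Suc M)
  let ?t = "\<lambda>M r. p ^ (r choose 2) * qbinomial p M r * a ^ (M - r) * b ^ r"
  have *: "?t (Suc M) (Suc r) = a * ?t M (Suc r) + b * p ^ M * ?t M r" if "r \<le> M" for r
  proof -
    have "p ^ (Suc r choose 2) * p ^ (M - r) = p ^ M * p ^ (r choose 2)"
      using that by (simp add: numeral_2_eq_2 add.commute flip: power_add)
    \<comment> \<open>At \<open>r = M\<close> the exponent \<open>M - Suc r\<close> truncates, but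
      the coefficient is then 0.\<close>
    moreover have "qbinomial p M (Suc r) * a ^ (M - r) = qbinomial p M (Suc r) * (a * a ^ (M - Suc r))"
      using that by (cases "r = M") (auto simp: qbinomial_eq_0 Suc_diff_Suc simp flip: power_Suc)
    moreover have "?t (Suc M) (Suc r) =
        (qbinomial p M (Suc r) * a ^ (M - r)) * (p ^ (Suc r choose 2) * b ^ Suc r) +
        (p ^ (Suc r choose 2) * p ^ (M - r)) * (qbinomial p M r * a ^ (M - r) * (b * b ^ r))"
      by (simp only: qbinomial.simps diff_Suc_Suc power_Suc distrib_left distrib_right mult_ac)
    ultimately show ?thesis
      by (simp only: power_Suc mult_ac)
  qed
  have "(\<Sum>r\<le>Suc M. ?t (Suc M) r) = a ^ Suc M + (\<Sum>r\<le>M. ?t (Suc M) (Suc r))"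
    by (subst sum.atMost_Suc_shift) (simp add: numeral_2_eq_2)
  also have "\<dots> = a ^ Suc M + (\<Sum>r\<le>M. a * ?t M (Suc r)) + (\<Sum>r\<le>M. b * p ^ M * ?t M r)"
    using * by (simp add: sum.distrib add.assoc)
  also have "a ^ Suc M + (\<Sum>r\<le>M. a * ?t M (Suc r)) = (\<Sum>r\<le>Suc M. a * ?t M r)"
    by (simp only: sum.atMost_Suc_shift) (simp add: numeral_2_eq_2)
  also have "\<dots> = (\<Sum>r\<le>M. a * ?t M r)"
    by (simp add: qbinomial_eq_0)
  finally have *: "(\<Sum>r\<le>Suc M. ?t (Suc M) r) =
      (\<Sum>r\<le>M. a * ?t M r) + (\<Sum>r\<le>M. b * p ^ M * ?t M r)" .
  show ?case
    unfolding * prod.lessThan_Suc Suc.IH distrib_left by (simp only: sum_distrib_left mult_ac)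
qed (simp add: numeral_2_eq_2)

lemma prod_lessThan_add: "(\<Prod>m<a + b. f m) = (\<Prod>m<a. f m) * (\<Prod>m<b. f (a + m))"
  for f :: "nat \<Rightarrow> 'a::comm_monoid_mult" and a b :: nat
  by (induction b) (simp_all add: mult_ac)

text \<open>The exponents form an arithmetic progression. This collects the monomials taken out of
  the lower factors of the finite triple product.\<close>

lemma prod_neg_power:
  "(\<Prod>m<Suc N. - (x ^ (d + 2 * k * m))) = (-1) ^ Suc N * x ^ (d * Suc N + k * N * Suc N)"
  for x :: "'a::comm_ring_1"
proof (induction N)
  case (Suc N)
  have "d * Suc (Suc N) + k * Suc N * Suc (Suc N) = (d * Suc N + k * N * Suc N) + (d + 2 * k * Suc N)"
    by (simp add: algebra_simps)
  then show ?case
    unfolding prod.lessThan_Suc[of _ "Suc N"] Suc by (simp only: power_add) simp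
qed simp

text \<open>Folds the sum about its middle: with bilateral index \<open>r - (N + 1)\<close>, the
  paired terms are those at \<open>n\<close> and \<open>- n - 1\<close>.\<close>

lemma sum_pair_outwards: "(\<Sum>r\<le>2 * N + 1. f r) = (\<Sum>n\<le>N. f (N + 1 + n) + f (N - n))"
  for f :: "nat \<Rightarrow> 'a::comm_monoid_add"
proof -
  have "{..2 * N + 1} = {..N} \<union> {N + 1..2 * N + 1}" by auto
  then have "(\<Sum>r\<le>2 * N + 1. f r) = (\<Sum>r\<le>N. f r) + (\<Sum>r=N + 1..2 * N + 1. f r)"
    by (simp only:) (rule sum.union_disjoint; auto)
  also have "(\<Sum>r\<le>N. f r) = (\<Sum>n\<le>N. f (N - n))"
    by (rule sum.reindex_bij_witness[of _ "\<lambda>n. N - n" "\<lambda>n. N - n"]) auto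
  also have "(\<Sum>r=N + 1..2 * N + 1. f r) = (\<Sum>n\<le>N. f (N + 1 + n))"
    by (rule sum.reindex_bij_witness[of _ "\<lambda>n. N + 1 + n" "\<lambda>n. n - (N + 1)"]) auto
  finally show ?thesis by (simp add: sum.distrib add.commute)
qed

text \<open>The q-binomial theorem is applied with the homogeneous factors
  \<open>x ^ (k * (2 * N + 1)) - x ^ d * x ^ (2 * k * m)\<close> for \<open>m < 2 * N + 1\<close>, so that no negative powers of
  \<open>x\<close> occur. The odd number of factors makes the terms at \<open>n\<close> and \<open>- n - 1\<close> of the
  bilateral sum share one q-binomial coefficient.\<close>

lemma finite_triple_product:
  fixes x :: "'a::idom"
  assumes x: "x \<noteq> 0" "\<And>m. m > 0 \<Longrightarrow> x ^ m \<noteq> 1" and "d \<le> k" "k > 0"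
  shows "(\<Prod>l<N. 1 - x ^ (k * (2 * l + 1) + d)) * (\<Prod>l<Suc N. 1 - x ^ (k * (2 * l + 1) - d)) =
    (\<Sum>n\<le>N. qbinomial (x ^ (2 * k)) (2 * N + 1) (N - n) *
      ((-1) ^ n * x ^ (k * n ^ 2 + d * n) * (1 - x ^ ((2 * n + 1) * (k - d)))))"
    (is "?P * ?P' = (\<Sum>n\<le>N. ?C n * ?t n)")
proof -
  define p where "p = x ^ (2 * k)"
  \<comment> \<open>\<open>K\<close> is the signed monomial taken out of all
    \<open>2 * N + 1\<close> factors. It is also common to every pair on the sum side, so it cancels
    at the end.\<close>
  define K where "K = (-1) ^ Suc N * x ^ (d * Suc N + k * N * Suc N + k * (2 * N + 1) * N)"
  have "K \<noteq> 0" using x by (simp add: K_def)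
  \<comment> \<open>For \<open>m <= N\<close> the second monomial has the smaller or equal exponent,
    for larger \<open>m\<close> the first one; that monomial is factored out.\<close>
  have low: "x ^ (k * (2 * N + 1)) - x ^ d * p ^ m =
      - (x ^ (d + 2 * k * m)) * (1 - x ^ (k * (2 * (N - m) + 1) - d))" if "m < Suc N" for m
  proof -
    obtain s where s: "N = m + s" using \<open>m < Suc N\<close> less_eq_Suc_le by (auto dest: le_Suc_ex)
    obtain c where c: "k = d + c" using le_Suc_ex[OF \<open>d \<le> k\<close>] by blast
    have "k * (2 * N + 1) = d + 2 * k * m + (k * (2 * (N - m) + 1) - d)"
      by (simp add: s c algebra_simps)
    then have "x ^ (k * (2 * N + 1)) = x ^ (d + 2 * k * m) * x ^ (k * (2 * (N - m) + 1) - d)"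
      by (simp only: power_add)
    moreover have "x ^ d * p ^ m = x ^ (d + 2 * k * m)"
      by (simp add: p_def power_add flip: power_mult)
    ultimately show ?thesis by (simp add: algebra_simps)
  qed
  have high: "x ^ (k * (2 * N + 1)) - x ^ d * p ^ (Suc N + m) =
      x ^ (k * (2 * N + 1)) * (1 - x ^ (k * (2 * m + 1) + d))" for m
  proof -
    have "x ^ d * p ^ (Suc N + m) = x ^ (d + 2 * k * (Suc N + m))"
      unfolding p_def power_add[of x d] by (simp only: power_mult[symmetric])
    also have "d + 2 * k * (Suc N + m) = k * (2 * N + 1) + (k * (2 * m + 1) + d)"
      by (simp add: algebra_simps)
    finally have e: "x ^ d * p ^ (Suc N + m) = x ^ (k * (2 * N + 1) + (k * (2 * m + 1) + d))" .
    show ?thesis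
      unfolding e power_add[of x "k * (2 * N + 1)"] by (simp only: right_diff_distrib mult_1_right)
  qed
  have "(\<Prod>m<2 * N + 1. x ^ (k * (2 * N + 1)) + - (x ^ d) * p ^ m) =
      (\<Prod>m<Suc N + N. x ^ (k * (2 * N + 1)) - x ^ d * p ^ m)"
    by (rule prod.cong) auto
  also have "\<dots> = (\<Prod>m<Suc N. - (x ^ (d + 2 * k * m)) * (1 - x ^ (k * (2 * (N - m) + 1) - d))) *
      (\<Prod>m<N. x ^ (k * (2 * N + 1)) * (1 - x ^ (k * (2 * m + 1) + d)))"
    unfolding prod_lessThan_add high using low by (intro arg_cong2[of _ _ _ _ "(*)"] prod.cong) auto
  also have "\<dots> = (\<Prod>m<Suc N. - (x ^ (d + 2 * k * m))) * (\<Prod>m<Suc N. 1 - x ^ (k * (2 * (N - m) + 1) - d)) *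
      (x ^ (k * (2 * N + 1) * N) * ?P)"
    by (simp only: prod.distrib prod_constant card_lessThan power_mult)
  also have "(\<Prod>m<Suc N. 1 - x ^ (k * (2 * (N - m) + 1) - d)) = ?P'"
    by (subst prod.nat_diff_reindex[symmetric]) simp
  also have "(\<Prod>m<Suc N. - (x ^ (d + 2 * k * m))) * ?P' * (x ^ (k * (2 * N + 1) * N) * ?P) = K * (?P * ?P')"
    unfolding prod_neg_power K_def power_add[of x "d * Suc N + k * N * Suc N"]
    by (simp only: mult_ac)
  finally have P: "(\<Prod>m<2 * N + 1. x ^ (k * (2 * N + 1)) + - (x ^ d) * p ^ m) = K * (?P * ?P')" .
  let ?F = "\<lambda>r. p ^ (r choose 2) * qbinomial p (2 * N + 1) r * (x ^ (k * (2 * N + 1))) ^ (2 * N + 1 - r) * (- (x ^ d)) ^ r"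
  have F: "?F r = (-1) ^ r * qbinomial p (2 * N + 1) r *
      x ^ (k * (r * (r - 1)) + k * (2 * N + 1) * (2 * N + 1 - r) + d * r)" for r
  proof -
    have "2 * (r choose 2) = r * (r - 1)" unfolding choose_two
      by (rule dvd_mult_div_cancel) (cases r; simp)
    moreover have "p ^ (r choose 2) = x ^ (k * (2 * (r choose 2)))"
      by (simp only: p_def power_mult[symmetric] mult_ac)
    ultimately have "p ^ (r choose 2) = x ^ (k * (r * (r - 1)))"
      by simp
    moreover have "(- (x ^ d)) ^ r = (-1) ^ r * x ^ (d * r)"
      by (subst power_minus) (simp only: power_mult)
    ultimately show ?thesis by (simp only: power_add power_mult[symmetric] mult_ac)
  qed
  have pair: "?F (N + 1 + n) + ?F (N - n) = K * (?C n * ?t n)" if "n \<le> N" for n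
  proof -
    \<comment> \<open>The substitutions make the exponents polynomial. Only \<open>N - n - 1\<close>
      still truncates, at \<open>s = 0\<close>, where its cofactor is 0.\<close>
    obtain s where s: "N = n + s" using le_Suc_ex[OF \<open>n \<le> N\<close>] by blast
    obtain c where c: "k = d + c" using le_Suc_ex[OF \<open>d \<le> k\<close>] by blast
    let ?e = "d * Suc N + k * N * Suc N + k * (2 * N + 1) * N"
    have e1: "k * ((N + 1 + n) * (N + 1 + n - 1)) + k * (2 * N + 1) * (2 * N + 1 - (N + 1 + n)) + d * (N + 1 + n)
       = ?e + (k * n\<^sup>2 + d * n)"
      by (simp add: s algebra_simps power2_eq_square)
    have e2: "k * ((N - n) * (N - n - 1)) + k * (2 * N + 1) * (2 * N + 1 - (N - n)) + d * (N - n)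
       = ?e + (k * n\<^sup>2 + d * n) + (2 * n + 1) * (k - d)"
      by (cases s) (simp_all add: s c algebra_simps power2_eq_square)
    have "qbinomial p (2 * N + 1) (N + 1 + n) = qbinomial p (2 * N + 1) (2 * N + 1 - (N - n))"
      using that by (intro arg_cong[of _ _ "qbinomial p (2 * N + 1)"]) simp
    also have "\<dots> = ?C n"
      unfolding p_def using x \<open>k > 0\<close> by (intro qbinomial_symmetric) (auto simp flip: power_mult)
    finally have C: "qbinomial p (2 * N + 1) (N + 1 + n) = ?C n" .
    \<comment> \<open>The two indices have odd sum, whence the opposite signs that produce the
      factor \<open>1 - w\<close> below.\<close>
    have m1: "(-1 :: 'a) ^ (N + 1 + n) = (-1) ^ Suc N * (-1) ^ n" "(-1 :: 'a) ^ (N - n) = - ((-1) ^ Suc N * (-1) ^ n)"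
      using that by (auto simp: minus_one_power_iff)
    have "(s * u) * c * (y * z) + (- (s * u)) * c * (y * z * w) = (s * y) * (c * (u * z * (1 - w)))"
      for s u c y z w :: 'a
      by (simp add: algebra_simps)
    then show ?thesis
      unfolding F unfolding e1 e2 C m1 K_def p_def[symmetric] power_add[of x ?e "k * n\<^sup>2 + d * n"]
        power_add[of x "?e + (k * n\<^sup>2 + d * n)" "(2 * n + 1) * (k - d)"] .
  qed
  have "K * (?P * ?P') = (\<Sum>r\<le>2 * N + 1. ?F r)"
    unfolding P[symmetric] by (rule qbinomial_theorem)
  also have "\<dots> = (\<Sum>n\<le>N. ?F (N + 1 + n) + ?F (N - n))"
    by (rule sum_pair_outwards)
  also have "\<dots> = K * (\<Sum>n\<le>N. ?C n * ?t n)"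
    unfolding sum_distrib_left by (rule sum.cong[OF refl], rule pair) simp
  finally show ?thesis using \<open>K \<noteq> 0\<close> by simp
qed


subsection \<open>The initial shelf\<close>

text \<open>Each factor is 1 modulo the ideal; \<open>0 \<le> m\<close> keeps the partial product in
  \<open>fls_ideal 0\<close>, so a further factor preserves the congruence.\<close>

lemma prod_one_minus_X_power:
  assumes "\<And>a. a \<in> A \<Longrightarrow> m \<le> int (e a)" "0 \<le> m"
  shows "(\<Prod>a\<in>A. 1 - fls_X ^ e a) - 1 \<in> (fls_ideal m :: 'a::idom fls set)"
  using assms(1)
proof (induction A rule: infinite_finite_induct)
  case (insert a A)
  let ?P = "\<Prod>a\<in>A. 1 - fls_X ^ e a :: 'a fls"
  have "?P - 1 \<in> fls_ideal m" "fls_X ^ e a \<in> (fls_ideal m :: 'a fls set)"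
    using insert by (auto intro: fls_ideal_X_power)
  moreover have "?P \<in> fls_ideal 0"
    using fls_ideal_add[OF fls_ideal_mono[OF \<open>?P - 1 \<in> fls_ideal m\<close> assms(2)] fls_ideal_1] by simp
  ultimately have "(?P - 1) - fls_X ^ e a * ?P \<in> fls_ideal m"
    by (meson fls_ideal_diff fls_ideal_mult0)
  then show ?case using insert by (simp add: algebra_simps)
qed auto

lemma one_minus_X_power_ideal: "1 - fls_X ^ e \<in> (fls_ideal 0 :: 'a::idom fls set)"
  by (intro fls_ideal_diff fls_ideal_1 fls_ideal_X_power) simp

lemma one_plus_X_power_ideal: "1 + fls_X ^ e \<in> (fls_ideal 0 :: 'a::idom fls set)"
  by (intro fls_ideal_add fls_ideal_1 fls_ideal_X_power) simp

lemma fls_X_power_neq_1: "m > 0 \<Longrightarrow> fls_X ^ m \<noteq> (1 :: 'a::idom fls)"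
proof
  assume "m > 0" "fls_X ^ m = (1 :: 'a fls)"
  then have "fls_subdegree (fls_X ^ m :: 'a fls) = 0" by simp
  with \<open>m > 0\<close> show False by (simp add: fls_subdegree_pow)
qed

lemma qpoch_ratio: "n \<le> M \<Longrightarrow> qpoch p M = qpoch p n * (\<Prod>m\<in>{n..<M}. 1 - p ^ Suc m)"
  unfolding qpoch_def by (simp add: prod.atLeastLessThan_concat lessThan_atLeast0)

text \<open>By the quotient formula only factors \<open>1 - p ^ s\<close> with
  \<open>s > N - n\<close> survive. The precision is weak for \<open>n\<close> near
  \<open>N\<close>, where the term weighted by this coefficient is itself small.\<close>

lemma qbinomial_near_1:
  assumes "n \<le> N" "k > 0"
  defines "p \<equiv> fls_X ^ (2 * k) :: 'a::idom fls"
  shows "qpoch p N * qbinomial p (2 * N + 1) (N - n) - 1 \<in> fls_ideal (int (2 * k * (N - n + 1)))"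
proof -
  have p: "p ^ m \<noteq> 1" if "m > 0" for m
    using that fls_X_power_neq_1[of "2 * k * m"] assms by (simp add: p_def flip: power_mult)
  have p_Suc: "p ^ Suc m = fls_X ^ (2 * k * Suc m)" for m
    by (simp only: p_def power_mult)
  have "2 * N + 1 - (N - n) = N + 1 + n" using assms by simp
  then have "qbinomial p (2 * N + 1) (N - n) * qpoch p (N - n) * qpoch p (N + 1 + n) = qpoch p (2 * N + 1)"
    using qbinomial_qpoch[of "N - n" "2 * N + 1" p] by simp
  also have "\<dots> = qpoch p (N + 1 + n) * (\<Prod>m\<in>{N + 1 + n..<2 * N + 1}. 1 - p ^ Suc m)"
    using assms by (intro qpoch_ratio) simp
  finally have "qbinomial p (2 * N + 1) (N - n) * qpoch p (N - n) = (\<Prod>m\<in>{N + 1 + n..<2 * N + 1}. 1 - p ^ Suc m)"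
    using qpoch_nonzero[OF p] by (simp add: mult_ac)
  then have "qpoch p N * qbinomial p (2 * N + 1) (N - n) =
      (\<Prod>m\<in>{N + 1 + n..<2 * N + 1}. 1 - p ^ Suc m) * (\<Prod>m\<in>{N - n..<N}. 1 - p ^ Suc m)"
    using qpoch_ratio[of "N - n" N p] by (simp add: mult_ac)
  also have "\<dots> = (\<Prod>m\<in>{N - n..<N} \<union> {N + 1 + n..<2 * N + 1}. 1 - fls_X ^ (2 * k * Suc m))"
    unfolding p_Suc by (subst prod.union_disjoint) (simp, simp, force, rule mult.commute)
  finally show ?thesis
    using assms by (auto intro!: prod_one_minus_X_power simp del: mult_Suc_right simp flip: of_nat_mult)
qed

text \<open>Multiplying the finite triple product by \<open>qpoch p N\<close> supplies the missing
  third kind of factor. Two errors remain, coefficients only close to 1 and one surplus factor, both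
  of order at least \<open>N\<close>.\<close>

lemma triple_product_near_sum:
  fixes k d N :: nat
  assumes "k > 0" "d < k"
  defines "t \<equiv> \<lambda>n. (-1) ^ n * fls_X ^ (k * n ^ 2 + d * n) * (1 - fls_X ^ ((2 * n + 1) * (k - d)))"
  shows "(\<Prod>m<N. (1 - fls_X ^ (2 * k * Suc m)) * (1 - fls_X ^ (k * (2 * m + 1) + d)) *
      (1 - fls_X ^ (k * (2 * m + 1) - d))) - (\<Sum>n\<le>N. t n) \<in> (fls_ideal (int N) :: 'a::idom fls set)"
    (is "?F - _ \<in> _")
proof -
  define p :: "'a fls" where "p = fls_X ^ (2 * k)"
  let ?c = "\<lambda>n. qpoch p N * qbinomial p (2 * N + 1) (N - n)"
  \<comment> \<open>The power in the surplus factor, at \<open>l = N\<close> of the longer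
    product.\<close>
  let ?x = "fls_X ^ (k * (2 * N + 1) - d) :: 'a fls"
  have q: "(\<Prod>m<N. 1 - fls_X ^ (2 * k * Suc m)) = qpoch p N"
    unfolding qpoch_def p_def power_mult ..
  have "?F * (1 - ?x) = qpoch p N *
     ((\<Prod>l<N. 1 - fls_X ^ (k * (2 * l + 1) + d)) * (\<Prod>l<Suc N. 1 - fls_X ^ (k * (2 * l + 1) - d)))"
    unfolding prod.distrib q prod.lessThan_Suc by (simp only: mult_ac)
  also have "\<dots> = qpoch p N * (\<Sum>n\<le>N. qbinomial p (2 * N + 1) (N - n) * t n)"
    unfolding t_def p_def using assms fls_X_power_neq_1 by (subst finite_triple_product) auto
  also have "\<dots> = (\<Sum>n\<le>N. ?c n * t n)"
    by (simp only: sum_distrib_left mult_ac)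
  finally have "?F * (1 - ?x) = (\<Sum>n\<le>N. ?c n * t n)" .
  then have eq: "?F - (\<Sum>n\<le>N. t n) = (\<Sum>n\<le>N. (?c n - 1) * t n) + ?x * ?F"
    by (simp add: algebra_simps sum_subtractf)
  have "(?c n - 1) * t n \<in> fls_ideal (int N)" if "n \<le> N" for n
  proof -
    have "t n = fls_X ^ (k * n ^ 2 + d * n) * ((-1) ^ n * (1 - fls_X ^ ((2 * n + 1) * (k - d))))"
      unfolding t_def by (simp only: mult_ac)
    also have "\<dots> \<in> fls_ideal (int (k * n ^ 2))"
      by (intro fls_ideal_mult0 fls_ideal_X_power fls_ideal_m1_power one_minus_X_power_ideal) simp
    finally have "(?c n - 1) * t n \<in> fls_ideal (int (2 * k * (N - n + 1)) + int (k * n ^ 2))"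
      unfolding p_def using qbinomial_near_1[OF that \<open>k > 0\<close>] by (rule fls_ideal_mult[rotated])
    moreover have "int N \<le> int (2 * k * (N - n + 1)) + int (k * n ^ 2)"
    proof -
      \<comment> \<open>The quadratic exponent of the term makes up for the loss of
        \<open>2 * n\<close> in the precision of its coefficient.\<close>
      have "2 * int n \<le> 1 + int n ^ 2"
        using zero_le_power2[of "int n - 1"] by (simp add: power2_diff)
      then have "int N \<le> 2 * (int N - int n + 1) + int n ^ 2"
        by simp
      also have "\<dots> \<le> int k * (2 * (int N - int n + 1) + int n ^ 2)"
        using mult_right_mono[of 1 "int k" "2 * (int N - int n + 1) + int n ^ 2"] assms that by simp
      also have "\<dots> = int (2 * k * (N - n + 1)) + int (k * n ^ 2)"
        unfolding of_nat_mult of_nat_add of_nat_diff[OF that] of_nat_power of_nat_numeral of_nat_1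
        by algebra
      finally show ?thesis .
    qed
    ultimately show ?thesis by (rule fls_ideal_mono)
  qed
  moreover have "?x * ?F \<in> fls_ideal (int N)"
  proof (intro fls_ideal_mult0 fls_ideal_X_power fls_ideal_prod one_minus_X_power_ideal)
    have "N * 1 + d \<le> N * (2 * k) + k" using assms by (intro add_mono mult_le_mono) auto
    then have "N + d \<le> k * (2 * N + 1)" by (simp add: algebra_simps)
    then show "int N \<le> int (k * (2 * N + 1) - d)"
      unfolding of_nat_le_iff by (rule add_le_imp_le_diff)
  qed
  ultimately show ?thesis
    unfolding eq by (intro fls_ideal_add fls_ideal_sum) auto
qed

text \<open>The denominator has constant term 1, hence is a unit of the power series ring.\<close>

lemma denominator_inverse_ideal: "1 / (qinf * (\<Prod>m = 1..j. 1 + q ^ m)) \<in> fls_ideal 0"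
proof -
  obtain D where D: "fps_nth D 0 = 1" "qinf * (\<Prod>m = 1..j. 1 + q ^ m) = fps_to_fls D"
    using denominator_fps by blast
  have "fps_to_fls D * fps_to_fls (inverse D) = 1"
    using D by (simp add: inverse_mult_eq_1' flip: fls_times_fps_to_fls)
  then have "1 / fps_to_fls D = fps_to_fls (inverse D)"
    using inverse_unique by (auto simp: divide_inverse)
  then show ?thesis
    using D(2) range_fps_to_fls by (metis rangeI)
qed

lemma RHS_term_ideal: "RHS_term k j i n \<in> fls_ideal 0"
proof -
  have "RHS_term k j i n = (-1) ^ n * (q ^ (k * n ^ 2 + ((k - 1) * j + i - 1) * n)
       * (1 - q ^ ((2 * n + j + 1) * (k - i + 1)))
       * (\<Prod>m = 1..j. 1 - q ^ (2 * (n + m)))) * (1 / (qinf * (\<Prod>m = 1..j. 1 + q ^ m)))"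
    by (simp add: RHS_term_def)
  also have "\<dots> \<in> fls_ideal 0"
    by (intro fls_ideal_mult0 fls_ideal_m1_power fls_ideal_X_power fls_ideal_prod
      one_minus_X_power_ideal denominator_inverse_ideal) simp
  finally show ?thesis .
qed

lemma ghost_RHS_term_ideal: "ghost_RHS_term k j i n \<in> fls_ideal 0"
proof -
  have "ghost_RHS_term k j i n = (-1) ^ n * (q ^ (k * n ^ 2 + ((k - 1) * j + i - 2) * n)
       * (\<Prod>m = 1..j. 1 - q ^ (2 * (n + m)))
       * (1 + q ^ (2 * n + j + 1))
       * (1 - q ^ ((2 * n + j + 1) * (k - i + 1)))) * (1 / (qinf * (\<Prod>m = 1..j + 1. 1 + q ^ m)))"
    by (simp add: ghost_RHS_term_def)
  also have "\<dots> \<in> fls_ideal 0"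
    by (intro fls_ideal_mult0 fls_ideal_m1_power fls_ideal_X_power fls_ideal_prod
      one_minus_X_power_ideal one_plus_X_power_ideal denominator_inverse_ideal) simp
  finally show ?thesis .
qed

lemma RHS_sums: "k \<ge> 2 \<Longrightarrow> RHS_term k j i sums RHS k j i"
  unfolding RHS_def by (rule summable_sums[OF RHS_summable])

lemma ghost_RHS_sums: "k \<ge> 2 \<Longrightarrow> ghost_RHS_term k j i sums ghost_RHS k j i"
  unfolding ghost_RHS_def by (rule summable_sums[OF ghost_RHS_summable])

lemma RHS_ideal: "k \<ge> 2 \<Longrightarrow> RHS k j i \<in> fls_ideal 0"
  by (rule sums_fls_ideal[OF RHS_sums RHS_term_ideal])

lemma ghost_RHS_ideal: "k \<ge> 2 \<Longrightarrow> ghost_RHS k j i \<in> fls_ideal 0"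
  by (rule sums_fls_ideal[OF ghost_RHS_sums ghost_RHS_term_ideal])

text \<open>Partial products and partial sums agree up to order \<open>N\<close>, so they share
  their limit.\<close>

lemma B_init_eq_RHS:
  assumes "k \<ge> 2" "i \<in> {1..k}"
  shows "B_init k i = RHS k 0 i"
proof -
  define f where "f = (\<lambda>m. (1 - q ^ (2 * k * Suc m))
          * (1 - q ^ (2 * k * Suc m - k + i - 1))
          * (1 - q ^ (2 * k * Suc m - k - i + 1)))"
  define d where "d = i - 1"
  define t :: "nat \<Rightarrow> complex fls" where
    "t = (\<lambda>n. (-1) ^ n * q ^ (k * n ^ 2 + d * n) * (1 - q ^ ((2 * n + 1) * (k - d))))"
  have d: "d < k" "i = Suc d" using assms by (auto simp: d_def)
  have f: "f m = (1 - q ^ (2 * k * Suc m)) * (1 - q ^ (k * (2 * m + 1) + d)) * (1 - q ^ (k * (2 * m + 1) - d))" for m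
  proof -
    have "2 * k * Suc m - k + i - 1 = k * (2 * m + 1) + d" "2 * k * Suc m - k - i + 1 = k * (2 * m + 1) - d"
      using d by (simp_all add: algebra_simps)
    then show ?thesis by (simp only: f_def)
  qed
  have near: "(\<Prod>m<N. f m) - (\<Sum>n\<le>N. t n) \<in> fls_ideal (int N)" for N
    unfolding f t_def using d assms by (intro triple_product_near_sum) auto
  have "f has_prod (\<Prod>m. f m)"
    unfolding f_def using assms by (intro B_init_has_prod) auto
  \<comment> \<open>\<open>has_prod\<close> also admits the value 0 when a factor vanishes;
    excluding this leaves plain convergence of the partial products.\<close>
  moreover have "f m \<noteq> 0" for m
  proof -
    have "k * (2 * m + 1) - d > 0" using d by (simp add: algebra_simps)
    then show ?thesis
      unfolding f using assms by (auto simp: eq_commute[of 1] fls_X_power_neq_1 simp del: mult_Suc_right)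
  qed
  ultimately have "(\<lambda>N. \<Prod>m\<le>N. f m) \<longlonglongrightarrow> (\<Prod>m. f m)"
    by (auto simp: has_prod_def raw_has_prod_def)
  then have lim: "(\<lambda>N. \<Prod>m<N. f m) \<longlonglongrightarrow> (\<Prod>m. f m)"
    by (simp add: LIMSEQ_lessThan_iff_atMost)
  have "t sums (\<Prod>m. f m)"
    unfolding sums_def_le tendsto_fls_iff
  proof
    fix m :: int
    have "\<forall>\<^sub>F N in sequentially. (\<Prod>m<N. f m) - (\<Prod>m. f m) \<in> fls_ideal m"
      using lim unfolding tendsto_fls_iff by blast
    then show "\<forall>\<^sub>F N in sequentially. (\<Sum>n\<le>N. t n) - (\<Prod>m. f m) \<in> fls_ideal m"
      using eventually_ge_at_top[of "nat m"]
    proof eventually_elim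
      case (elim N)
      then have "(\<Prod>m<N. f m) - (\<Sum>n\<le>N. t n) \<in> fls_ideal m"
        using fls_ideal_mono[OF near] by (simp add: nat_le_iff)
      from fls_ideal_diff[OF elim(1) this] show ?case by simp
    qed
  qed
  from sums_fls_mult[OF this, of "1 / qinf"] have "(\<lambda>n. 1 / qinf * t n) sums B_init k i"
    by (simp add: B_init_def f_def)
  also have "(\<lambda>n. 1 / qinf * t n) = RHS_term k 0 i"
  proof
    fix n
    have "(k - 1) * 0 + i - 1 = d" "k - i + 1 = k - d" using d by auto
    then show "1 / qinf * t n = RHS_term k 0 i n"
      unfolding RHS_term_def t_def by (simp add: mult.assoc)
  qed
  finally show ?thesis
    by (rule sums_unique2[OF _ RHS_sums[OF assms(1)]])
qed


subsection \<open>From one shelf to the next\<close>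

lemma one_plus_q_power_nonzero: "1 + q ^ e \<noteq> 0"
proof
  assume "1 + q ^ e = 0"
  moreover have "fls_nth (1 + q ^ e) 0 \<noteq> 0"
    by (cases "e = 0") (auto simp: fls_X_power_nth)
  ultimately show False by simp
qed

text \<open>Passing from \<open>i - 1\<close> to \<open>i + 1\<close> adds \<open>2 * n\<close> to
  the exponent, which together with \<open>q ^ (j + 1)\<close> gives the factor \<open>w\<close>. At
  \<open>i = k\<close> the explicit 0 matters: truncation makes \<open>k - (k + 1) + 1\<close> equal
  to 1, not 0.\<close>

lemma ghost_RHS_term_eq:
  assumes "2 \<le> i" "i \<le> k"
  shows "ghost_RHS_term k j i n =
    1 / (1 + q ^ (j + 1)) * (RHS_term k j (i - 1) n +
      (if i = k then 0 else q ^ (j + 1)) * RHS_term k j (i + 1) n)"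
proof -
  define l where "l = k - i"
  define w where "w = q ^ (2 * n + j + 1)"
  define E where "E = k * n ^ 2 + ((k - 1) * j + i - 2) * n"
  define D where "D = qinf * (\<Prod>m = 1..j. 1 + q ^ m)"
  define P where "P = (\<Prod>m = 1..j. 1 - q ^ (2 * (n + m)))"
  have "(k - 1) * j + (i + 1) - 1 = (k - 1) * j + i - 2 + 2"
    using assms by simp
  then have E2: "k * n ^ 2 + ((k - 1) * j + (i + 1) - 1) * n = E + 2 * n"
    by (simp only: E_def distrib_right add.assoc)
  have e: "(k - 1) * j + (i - 1) - 1 = (k - 1) * j + i - 2"
      "k - (i - 1) + 1 = l + 2" "k - i + 1 = l + 1" "i \<noteq> k \<Longrightarrow> k - (i + 1) + 1 = l"
    using assms by (simp_all add: l_def)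
  have g: "ghost_RHS_term k j i n = (-1) ^ n * (q ^ E * P * (1 + w) * (1 - w ^ (l + 1))) / (D * (1 + q ^ (j + 1)))"
    unfolding ghost_RHS_term_def e E_def[symmetric] P_def[symmetric] D_def w_def power_mult[symmetric]
    by (simp add: mult.assoc)
  have r: "RHS_term k j (i - 1) n = (-1) ^ n * (q ^ E * (1 - w ^ (l + 2)) * P) / D"
    unfolding RHS_term_def e E_def[symmetric] P_def[symmetric] D_def w_def power_mult[symmetric] ..
  have r': "q ^ (j + 1) * RHS_term k j (i + 1) n = (-1) ^ n * (q ^ E * (w * (1 - w ^ l)) * P) / D" if "i \<noteq> k"
    unfolding RHS_term_def E2 e(4)[OF that] P_def[symmetric] D_def w_def power_mult[symmetric]
    by (simp add: power_add mult_ac)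
  have "RHS_term k j (i - 1) n + (if i = k then 0 else q ^ (j + 1)) * RHS_term k j (i + 1) n =
      (-1) ^ n * (q ^ E * P * ((1 + w) * (1 - w ^ (l + 1)))) / D"
  proof (cases "i = k")
    case True
    then have "l = 0" by (simp add: l_def)
    then show ?thesis using True unfolding r by (simp add: algebra_simps power2_eq_square)
  next
    case False
    have "s * (e * (1 - w ^ (l + 2)) * P) / D + s * (e * (w * (1 - w ^ l)) * P) / D =
        s * (e * P * ((1 + w) * (1 - w ^ (l + 1)))) / D" for s e P D :: "complex fls"
      unfolding divide_inverse by (simp add: algebra_simps)
    then show ?thesis using False unfolding r by (simp only: if_False r' if_True not_False_eq_True)
  qed
  then show ?thesis
    unfolding g by (simp add: mult_ac)
qed

lemma ghost_step_RHS:
  assumes "k \<ge> 2" "2 \<le> i" "i \<le> k"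
  shows "ghost_step k j (RHS k j) i = ghost_RHS k j i"
proof -
  have "ghost_RHS_term k j i sums (1 / (1 + q ^ (j + 1)) * (RHS k j (i - 1) +
      (if i = k then 0 else q ^ (j + 1)) * RHS k j (i + 1)))"
    unfolding ghost_RHS_term_eq[OF assms(2,3), abs_def]
    by (intro sums_fls_mult sums_fls_add RHS_sums assms)
  then have "ghost_RHS k j i = 1 / (1 + q ^ (j + 1)) * (RHS k j (i - 1) +
      (if i = k then 0 else q ^ (j + 1)) * RHS k j (i + 1))"
    by (rule sums_unique2[OF ghost_RHS_sums[OF assms(1)]])
  then show ?thesis by (simp add: ghost_step_def)
qed

text \<open>The next shelf does not arise termwise: a term of the difference on the right of
  \<open>RHS_term_next_shelf\<close> splits in two parts, and the first part of the \<open>n + 1\<close>st term belongs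
  to the \<open>n\<close>th term of the next shelf. This first part is \<open>shelf_corr\<close>; its factor for \<open>m = 0\<close>
  makes it vanish at \<open>n = 0\<close>.\<close>

definition shelf_corr :: "nat \<Rightarrow> nat \<Rightarrow> nat \<Rightarrow> nat \<Rightarrow> complex fls" where
  "shelf_corr k j i n = (-1) ^ n * (q ^ (k * n ^ 2 + ((k - 1) * j + k - i) * n + (j + 1))
     * (\<Prod>m = 0..j. 1 - q ^ (2 * (n + m)))) / (qinf * (\<Prod>m = 1..j + 1. 1 + q ^ m))"

lemma shelf_corr_0: "shelf_corr k j i 0 = 0"
  by (simp add: shelf_corr_def prod.atLeast_Suc_atMost)

lemma shelf_corr_ideal:
  assumes "k \<ge> 2"
  shows "shelf_corr k j i n \<in> fls_ideal (int n)"
proof -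
  have "shelf_corr k j i n = q ^ (k * n ^ 2 + ((k - 1) * j + k - i) * n + (j + 1)) *
     (\<Prod>m = 0..j. 1 - q ^ (2 * (n + m))) * (-1) ^ n * (1 / (qinf * (\<Prod>m = 1..j + 1. 1 + q ^ m)))"
    unfolding shelf_corr_def by (simp add: mult_ac)
  also have "\<dots> \<in> fls_ideal (int n)"
  proof (intro fls_ideal_mult0 fls_ideal_m1_power fls_ideal_X_power fls_ideal_prod
      one_minus_X_power_ideal denominator_inverse_ideal)
    show "int n \<le> int (k * n ^ 2 + ((k - 1) * j + k - i) * n + (j + 1))"
      unfolding of_nat_le_iff using exponent_ge[OF assms, of n "(k - 1) * j + k - i"] by (rule trans_le_add1)
  qed
  finally show ?thesis .
qed

text \<open>The case \<open>i = 1\<close>, where the ghost term degenerates to \<open>0\<close>, is the edge matching of part (b).\<close>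

lemma RHS_term_next_shelf:
  assumes "k \<ge> 2" "i \<in> {1..k}"
  shows "q ^ ((j + 1) * (i - 1)) * RHS_term k (j + 1) i n =
    RHS_term k j (k - i + 1) n - (if i = 1 then 0 else ghost_RHS_term k j (k - i + 2) n)
      + (shelf_corr k j i (Suc n) - shelf_corr k j i n)"
proof -
  define a where "a = i - 1"
  define l where "l = k - i"
  define Q where "Q = q ^ (2 * n)"
  define y where "y = q ^ (j + 1)"
  define w where "w = q ^ (2 * n + j + 1)"
  define E where "E = k * n ^ 2 + ((k - 1) * j + k - i) * n"
  define D where "D = qinf * (\<Prod>m = 1..j + 1. 1 + q ^ m)"
  define P where "P = (\<Prod>m = 1..j. 1 - q ^ (2 * (n + m)))"
  have i: "i = a + 1" "k = l + a + 1" using assms by (auto simp: a_def l_def)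
  have w: "w = y * Q" by (simp add: w_def y_def Q_def add_ac flip: power_add)
  have "1 + y \<noteq> 0" unfolding y_def by (rule one_plus_q_power_nonzero)
  have D: "D = qinf * (\<Prod>m = 1..j. 1 + q ^ m) * (1 + y)"
    by (simp add: D_def y_def mult.assoc)
  have yw: "y * w = q ^ (2 * (n + (j + 1)))"
    unfolding y_def w_def power_add[symmetric] by (rule arg_cong[of _ _ "power q"]) simp
  have P1: "(\<Prod>m = 1..j + 1. 1 - q ^ (2 * (n + m))) = P * (1 - y * w)"
    unfolding yw P_def by simp
  have P0: "(\<Prod>m = 0..j. 1 - q ^ (2 * (n + m))) = (1 - Q) * P"
    by (simp add: P_def Q_def prod.atLeast_Suc_atMost)
  have PS: "(\<Prod>m = 0..j. 1 - q ^ (2 * (Suc n + m))) = P * (1 - y * w)"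
    unfolding P1[symmetric]
    by (rule prod.reindex_bij_witness[of _ "\<lambda>m. m - 1" Suc]) auto
  \<comment> \<open>\<open>V\<close> enters the term of the new shelf and, by \<open>eS\<close>, the
    shifted correction; the two occurrences cancel in the final identity.\<close>
  define V where "V = q ^ ((2 * n + j + 2) * (l + 1))"
  have e1: "(j + 1) * a + (k * n ^ 2 + ((k - 1) * (j + 1) + a) * n) = E + (2 * n + j + 1) * a"
    by (simp add: i E_def algebra_simps)
  have eS: "k * (Suc n) ^ 2 + ((k - 1) * j + k - i) * Suc n + (j + 1) =
      E + (2 * n + j + 1) * a + (2 * n + j + 2) * (l + 1)"
    by (simp add: i E_def algebra_simps power2_eq_square)
  have t1: "q ^ ((j + 1) * (i - 1)) * RHS_term k (j + 1) i n =
      (-1) ^ n * (q ^ E * w ^ a * (1 - V) * (P * (1 - y * w))) / D"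
  proof -
    have "q ^ ((j + 1) * a) * q ^ (k * n ^ 2 + ((k - 1) * (j + 1) + a) * n) = q ^ E * w ^ a"
      unfolding power_add[symmetric] e1 w_def power_mult[symmetric] ..
    moreover have "RHS_term k (j + 1) i n = (-1) ^ n *
        (q ^ (k * n ^ 2 + ((k - 1) * (j + 1) + a) * n) * (1 - V) * (P * (1 - y * w))) / D"
      unfolding RHS_term_def P1[symmetric] D_def V_def by (simp add: i add_ac)
    ultimately show ?thesis
      by (simp add: a_def mult_ac)
  qed
  have t2: "RHS_term k j (k - i + 1) n = (-1) ^ n * (q ^ E * (1 - w * w ^ a) * P) * (1 + y) / D"
  proof -
    have "(k - 1) * j + (k - i + 1) - 1 = (k - 1) * j + k - i" "k - (k - i + 1) + 1 = Suc a"
      by (simp_all add: i)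
    then have "RHS_term k j (k - i + 1) n =
        (-1) ^ n * (q ^ E * (1 - w ^ Suc a) * P) / (qinf * (\<Prod>m = 1..j. 1 + q ^ m))"
      unfolding RHS_term_def E_def P_def w_def power_mult[symmetric] by simp
    then show ?thesis
      using \<open>1 + y \<noteq> 0\<close> by (simp add: D)
  qed
  \<comment> \<open>For \<open>i = 1\<close> the exponent \<open>a\<close> is 0 and the right side
    vanishes by itself, so one formula covers the edge case.\<close>
  have t3: "(if i = 1 then 0 else ghost_RHS_term k j (k - i + 2) n) =
      (-1) ^ n * (q ^ E * P * (1 + w) * (1 - w ^ a)) / D"
  proof (cases "i = 1")
    case False
    then have "(k - 1) * j + (k - i + 2) - 2 = (k - 1) * j + k - i" "k - (k - i + 2) + 1 = a"
      by (simp_all add: i)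
    then show ?thesis
      using False unfolding ghost_RHS_term_def E_def P_def w_def D_def power_mult[symmetric] by simp
  qed (simp add: a_def)
  have t4: "shelf_corr k j i n = (-1) ^ n * (q ^ E * y * ((1 - Q) * P)) / D"
    unfolding shelf_corr_def P0 D_def E_def y_def by (simp add: power_add)
  have t5: "shelf_corr k j i (Suc n) = - ((-1) ^ n) * (q ^ E * w ^ a * V * (P * (1 - y * w))) / D"
  proof -
    have "q ^ (E + (2 * n + j + 1) * a + (2 * n + j + 2) * (l + 1)) = q ^ E * w ^ a * V"
      unfolding V_def w_def power_mult[symmetric] power_add[symmetric] ..
    then show ?thesis
      unfolding shelf_corr_def PS D_def[symmetric] eS by simp
  qed
  define c where "c = (-1) ^ n * q ^ E * P / D"
  have "q ^ ((j + 1) * (i - 1)) * RHS_term k (j + 1) i n = c * (w ^ a * (1 - V) * (1 - y * w))"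
    unfolding t1 c_def by (simp add: mult_ac)
  \<comment> \<open>The parts with \<open>V\<close> agree; the rest is a polynomial identity because
    \<open>w = y * Q\<close>.\<close>
  also have "w ^ a * (1 - V) * (1 - y * w) = (1 - w * w ^ a) * (1 + y) - (1 + w) * (1 - w ^ a)
      + (- (w ^ a * V * (1 - y * w)) - y * (1 - Q))"
    by (simp add: w algebra_simps)
  also have "c * \<dots> = RHS_term k j (k - i + 1) n - (if i = 1 then 0 else ghost_RHS_term k j (k - i + 2) n)
      + (shelf_corr k j i (Suc n) - shelf_corr k j i n)"
  proof -
    have "RHS_term k j (k - i + 1) n = c * ((1 - w * w ^ a) * (1 + y))"
      unfolding t2 c_def by (simp add: mult_ac)
    moreover have "(if i = 1 then 0 else ghost_RHS_term k j (k - i + 2) n) = c * ((1 + w) * (1 - w ^ a))"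
      unfolding t3 c_def by (simp add: mult_ac)
    moreover have "shelf_corr k j i (Suc n) = c * (- (w ^ a * V * (1 - y * w)))"
      unfolding t5 c_def by (simp add: mult_ac)
    moreover have "shelf_corr k j i n = c * (y * (1 - Q))"
      unfolding t4 c_def by (simp add: mult_ac)
    ultimately show ?thesis
      by (simp only: distrib_left right_diff_distrib)
  qed
  finally show ?thesis .
qed

text \<open>Sums the termwise relation; the corrections telescope to 0.\<close>

lemma RHS_next_shelf:
  assumes "k \<ge> 2" "i \<in> {1..k}"
  shows "q ^ ((j + 1) * (i - 1)) * RHS k (j + 1) i =
    RHS k j (k - i + 1) - (if i = 1 then 0 else ghost_RHS k j (k - i + 2))"
proof -
  have "(\<lambda>n. if i = 1 then 0 else ghost_RHS_term k j (k - i + 2) n) sums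
      (if i = 1 then 0 else ghost_RHS k j (k - i + 2))"
    using ghost_RHS_sums[OF assms(1)] by simp
  then have "(\<lambda>n. q ^ ((j + 1) * (i - 1)) * RHS_term k (j + 1) i n) sums
      (RHS k j (k - i + 1) - (if i = 1 then 0 else ghost_RHS k j (k - i + 2)) + 0)"
    unfolding RHS_term_next_shelf[OF assms]
    by (intro sums_fls_add sums_fls_diff RHS_sums sums_fls_telescope shelf_corr_0 shelf_corr_ideal assms)
  from sums_unique2[OF sums_fls_mult[OF RHS_sums[OF assms(1)]] this] show ?thesis
    by simp
qed

text \<open>The closed forms satisfy the recursion defining the shelves; position 1 is the edge
  matching.\<close>

lemma shelf_eq_RHS:
  assumes "k \<ge> 2" "i \<in> {1..k}"
  shows "shelf k j i = RHS k j i"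
  using assms(2)
proof (induction j arbitrary: i)
  case 0
  then show ?case using B_init_eq_RHS assms(1) by simp
next
  case (Suc j)
  show ?case
  proof (cases "i = 1")
    case True
    then show ?thesis using RHS_next_shelf[OF assms(1) Suc.prems, of j] Suc.IH[of k] assms(1) by simp
  next
    case False
    have "ghost_step k j (shelf k j) (k - i + 2) = ghost_step k j (RHS k j) (k - i + 2)"
      using False Suc by (intro ghost_step_cong) auto
    also have "\<dots> = ghost_RHS k j (k - i + 2)"
      using False Suc.prems assms(1) by (intro ghost_step_RHS) auto
    finally have "shelf k j (k - i + 1) - ghost_step k j (shelf k j) (k - i + 2) =
        RHS k j (k - i + 1) - ghost_RHS k j (k - i + 2)"
      using Suc.IH[of "k - i + 1"] Suc.prems by auto
    also have "\<dots> = q ^ ((j + 1) * (i - 1)) * RHS k (j + 1) i"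
      using False RHS_next_shelf[OF assms(1) Suc.prems, of j] by simp
    finally have "shelf k (Suc j) i =
        (q ^ ((j + 1) * (i - 1)) * RHS k (j + 1) i) / q ^ ((j + 1) * (i - 1))"
      using False by (simp only: shelf.simps if_False)
    also have "\<dots> = RHS k (j + 1) i"
      by (rule nonzero_mult_div_cancel_left) simp
    finally show ?thesis by simp
  qed
qed

theorem theorem4p1:
  fixes k :: nat
  assumes "k \<ge> 2"
  shows
    "(\<forall>j. \<forall>i\<in>{1..k}.
        B k ((k - 1) * j + i) \<in> range fps_to_fls \<and>
        B k ((k - 1) * j + i) = RHS k j i) \<and>
     (\<forall>j\<ge>1. RHS k (j - 1) k = RHS k j 1) \<and>
     (\<forall>j. \<forall>i\<in>{2..k}.
        ghostB k ((k - 1) * j + i) \<in> range fps_to_fls \<and>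
        ghostB k ((k - 1) * j + i) = ghost_RHS k j i)"
proof (intro conjI allI ballI impI)
  fix j i :: nat
  assume "i \<in> {1..k}"
  then show "B k ((k - 1) * j + i) = RHS k j i"
    using B_shelf shelf_eq_RHS assms by simp
  then show "B k ((k - 1) * j + i) \<in> range fps_to_fls"
    using RHS_ideal assms by (simp add: range_fps_to_fls)
next
  fix j :: nat
  assume "1 \<le> j"
  then show "RHS k (j - 1) k = RHS k j 1"
    using RHS_next_shelf[of k 1 "j - 1"] assms by simp
next
  fix j i :: nat
  assume i: "i \<in> {2..k}"
  have "ghostB k ((k - 1) * j + i) = ghost_step k j (\<lambda>i'. B k ((k - 1) * j + i')) i"
    using i by (intro ghostB_eq) auto
  also have "\<dots> = ghost_step k j (RHS k j) i"
    using i B_shelf shelf_eq_RHS assms by (intro ghost_step_cong) auto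
  also have "\<dots> = ghost_RHS k j i"
    using i assms by (intro ghost_step_RHS) auto
  finally show "ghostB k ((k - 1) * j + i) = ghost_RHS k j i" .
  then show "ghostB k ((k - 1) * j + i) \<in> range fps_to_fls"
    using ghost_RHS_ideal assms by (simp add: range_fps_to_fls)
qed

end
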